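(* Let $K$ be an algebraically closed field, $q$ a positive integer and $V\subseteq\mathbb{P}_{n-1}(K)$ a zero-dimensional projective variety. For every $q$-Kakeya set $E$ with directions in $V$, $$\sharp(E)\ge\chi_V(d),\qquad\forall d\in\mathbb{N},\ d\le q-1.$$ Moreover, if $R$ is the regularity of the Hilbert function of $V$ and $q-1\ge R$, then $$\sharp(E)\ge\sharp(V)=\deg(V).$$ On the other hand, $q$-Kakeya sets with directions in $V$ of cardinality $(q-1)\deg(V)+1$ do exist.
   Context: A zero-dimensional projective variety is a finite (non-empty) set of points of $\mathbb{P}_{n-1}(K)$; its degree is its cardinality. For $v\in\mathbb{P}_{n-1}(K)$, $K\langle v\rangle\subseteq K^n$ is the one-dimensional subspace spanned by any representative of $v$. A $q$-Kakeya set with directions in $V$ is a finite subset $E\subseteq\mathbb{A}^n(K)=K^n$ such that for every $v\in V$ there is a point $x\in E$ such that the affine line $\rho(x,v):=x+K\langle v\rangle$ satisfies $\sharp(E\cap\rho(x,v))\ge q$. Hilbert function: $\chi_V(m):=\dim_K\big(H_m(X_1,\ldots,X_n)/I_m(V)\big)$, where $H_m(X_1,\ldots,X_n)$ is the $K$-vector space of homogeneous polynomials of degree $m$ (including $0$) and $I_m(V)$ is its subspace of polynomials vanishing on $V$. There are a unique polynomial $h\in\mathbb{Z}[T]$ (the Hilbert polynomial; here constant) and an integer $R$ with $\chi_V(m)=h(m)$ for all $m\ge R$; the minimal such $R$ is the regularity of the Hilbert function of $V$. *)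

theory Defs
  imports
    "HOL-Analysis.Cartesian_Space"
    "HOL-Computational_Algebra.Polynomial"
    "HOL-Library.Poly_Mapping"
begin

text \<open>
  \<open>smul\<close> is the scalar multiplication of a vector space.  The residue classes modulo \<open>U\<close> of the vectors in the finite set \<open>B \<subseteq> W\<close> are pairwise distinct
  and form a basis of \<open>W / U\<close>: a linear combination of classes is zero in \<open>W / U\<close> iff the
  corresponding combination of representatives lies in \<open>U\<close>.
\<close>
definition quotient_basis :: "('a::field \<Rightarrow> 'b::ab_group_add \<Rightarrow> 'b) \<Rightarrow> 'b set \<Rightarrow> 'b set \<Rightarrow> 'b set \<Rightarrow> bool" where
  "quotient_basis smul W U B \<longleftrightarrow>
     finite B \<and> B \<subseteq> W \<and>
     (\<forall>c. (\<Sum>b\<in>B. smul (c b) b) \<in> U \<longrightarrow> (\<forall>b\<in>B. c b = 0)) \<and>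
     (\<forall>w\<in>W. \<exists>c. w - (\<Sum>b\<in>B. smul (c b) b) \<in> U)"

text \<open>Only meaningful if \<open>W / U\<close> is finite-dimensional.\<close>
definition dim_quotient :: "('a::field \<Rightarrow> 'b::ab_group_add \<Rightarrow> 'b) \<Rightarrow> 'b set \<Rightarrow> 'b set \<Rightarrow> nat" where
  "dim_quotient smul W U = (THE k. \<exists>B. quotient_basis smul W U B \<and> card B = k)"

context vector_space
begin

lemma quotient_basis_card:
  assumes U: "subspace U" and W: "subspace W" and UW: "U \<subseteq> W"
    and S: "finite S" "W \<subseteq> span S" and B: "quotient_basis scale W U B"
  shows "card B + dim U = dim W"
proof -
  have finB: "finite B" and BW: "B \<subseteq> W"
    and indep: "\<And>c. (\<Sum>b\<in>B. scale (c b) b) \<in> U \<Longrightarrow> \<forall>b\<in>B. c b = 0"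
    and spans: "\<And>w. w \<in> W \<Longrightarrow> \<exists>c. w - (\<Sum>b\<in>B. scale (c b) b) \<in> U"
    using B by (auto simp: quotient_basis_def)
  obtain C where C: "C \<subseteq> U" "independent C" "U \<subseteq> span C" "card C = dim U"
    by (rule basis_exists)
  have finC: "finite C"
    using independent_span_bound[of S C] C S UW by auto
  have disj: "b \<notin> U" if "b \<in> B" for b
  proof
    assume "b \<in> U"
    moreover have "(\<Sum>x\<in>B. scale (if x = b then 1 else 0) x) = b"
      using that finB by (simp add: if_distrib[of "\<lambda>c. scale c _"] cong: if_cong)
    ultimately show False using indep[of "\<lambda>x. if x = b then 1 else 0"] that by auto
  qed
  hence BC: "B \<inter> C = {}" using C by auto
  have "independent (B \<union> C)"
    unfolding independent_explicit_module
  proof (intro allI impI)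
    fix T u v assume T: "finite T" "T \<subseteq> B \<union> C" "(\<Sum>v\<in>T. scale (u v) v) = 0" "v \<in> T"
    define u' where "u' x = (if x \<in> T then u x else 0)" for x
    have "(\<Sum>x\<in>B \<union> C. scale (u' x) x) = (\<Sum>v\<in>T. scale (u v) v)"
      using T finB finC by (intro sum.mono_neutral_cong_right) (auto simp: u'_def)
    hence eq: "(\<Sum>x\<in>B. scale (u' x) x) + (\<Sum>x\<in>C. scale (u' x) x) = 0"
      using T(3) BC finB finC by (simp add: sum.union_disjoint)
    have inU: "(\<Sum>x\<in>C. scale (u' x) x) \<in> U"
      using C U by (auto intro!: subspace_sum subspace_scale)
    have "(\<Sum>x\<in>B. scale (u' x) x) = - (\<Sum>x\<in>C. scale (u' x) x)"
      using eq by (simp add: eq_neg_iff_add_eq_0)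
    hence "(\<Sum>x\<in>B. scale (u' x) x) \<in> U" using inU U by (simp add: subspace_neg)
    hence z: "\<forall>b\<in>B. u' b = 0" by (rule indep)
    hence "(\<Sum>x\<in>C. scale (u' x) x) = 0" using eq by simp
    hence "\<forall>x\<in>C. u' x = 0" using C(2) finC by (auto simp: independent_explicit_module)
    thus "u v = 0" using z T by (auto simp: u'_def split: if_splits)
  qed
  moreover have "W \<subseteq> span (B \<union> C)"
  proof
    fix w assume "w \<in> W"
    then obtain c where "w - (\<Sum>b\<in>B. scale (c b) b) \<in> U" using spans by blast
    hence "w - (\<Sum>b\<in>B. scale (c b) b) \<in> span (B \<union> C)"
      using C(3) span_mono[of C "B \<union> C"] by auto
    moreover have "(\<Sum>b\<in>B. scale (c b) b) \<in> span (B \<union> C)"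
      by (intro span_sum span_scale span_base) auto
    ultimately have "w - (\<Sum>b\<in>B. scale (c b) b) + (\<Sum>b\<in>B. scale (c b) b) \<in> span (B \<union> C)"
      by (rule span_add)
    thus "w \<in> span (B \<union> C)" by simp
  qed
  ultimately have "card (B \<union> C) = dim W"
    using BW C(1) UW by (intro basis_card_eq_dim) auto
  thus ?thesis using BC finB finC C(4) by (simp add: card_Un_disjoint)
qed

lemma quotient_basis_exists:
  assumes U: "subspace U" and UW: "U \<subseteq> W" and S: "finite S" "W \<subseteq> span S"
  shows "\<exists>B. quotient_basis scale W U B"
proof -
  obtain C where C: "C \<subseteq> U" "independent C" "U \<subseteq> span C"
    by (rule basis_exists)
  obtain D where D: "C \<subseteq> D" "D \<subseteq> W" "independent D" "W \<subseteq> span D"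
    using maximal_independent_subset_extend[OF subset_trans[OF C(1) UW] C(2)] by blast
  have finD: "finite D" using independent_span_bound[of S D] D S by auto
  have finC: "finite C" using D finD finite_subset by blast
  have spC: "span C = U" using C U by (simp add: span_unique subspace_span span_minimal subset_antisym)
  have "quotient_basis scale W U (D - C)"
    unfolding quotient_basis_def
  proof (intro conjI allI impI ballI)
    show "finite (D - C)" "D - C \<subseteq> W" using finD D by auto
  next
    fix c b assume "(\<Sum>b\<in>D - C. scale (c b) b) \<in> U" and b: "b \<in> D - C"
    then obtain e where e: "(\<Sum>b\<in>D - C. scale (c b) b) = (\<Sum>x\<in>C. scale (e x) x)"
      using spC span_finite[OF finC] by auto
    define u where "u x = (if x \<in> C then - e x else c x)" for x
    have "(\<Sum>x\<in>D. scale (u x) x) = (\<Sum>x\<in>D - C. scale (u x) x) + (\<Sum>x\<in>C. scale (u x) x)"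
      by (rule sum.subset_diff[OF D(1) finD])
    also have "\<dots> = 0" using e by (simp add: u_def sum_negf)
    finally have "u b = 0" using D(3) finD b by (auto simp: independent_explicit_module)
    thus "c b = 0" using b by (simp add: u_def)
  next
    fix w assume "w \<in> W"
    then obtain e where e: "w = (\<Sum>x\<in>D. scale (e x) x)"
      using D(4) span_finite[OF finD] by auto
    have "w - (\<Sum>x\<in>D - C. scale (e x) x) = (\<Sum>x\<in>C. scale (e x) x)"
      unfolding e by (subst sum.subset_diff[OF D(1) finD]) simp
    also have "\<dots> \<in> U" using C U by (auto intro!: subspace_sum subspace_scale)
    finally show "\<exists>c. w - (\<Sum>x\<in>D - C. scale (c x) x) \<in> U" by blast
  qed
  thus ?thesis by blast
qed

lemma dim_quotient_plus_dim:
  assumes "subspace U" "subspace W" "U \<subseteq> W" "finite S" "W \<subseteq> span S"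
  shows "dim_quotient scale W U + dim U = dim W"
proof -
  obtain B where B: "quotient_basis scale W U B"
    using local.quotient_basis_exists assms by blast
  have "dim_quotient scale W U = card B"
    unfolding dim_quotient_def
  proof (rule the_equality)
    fix k assume "\<exists>B'. quotient_basis scale W U B' \<and> card B' = k"
    then obtain B' where "quotient_basis scale W U B'" "card B' = k" by blast
    thus "k = card B"
      using local.quotient_basis_card[OF assms, of B] local.quotient_basis_card[OF assms, of B'] B by simp
  qed (use B in blast)
  thus ?thesis using local.quotient_basis_card[OF assms B] by simp
qed

end

text \<open>
  A monomial is an exponent vector \<open>'n \<Rightarrow>\<^sub>0 nat\<close>, and a polynomial over \<open>'k\<close> in the variables
  \<open>X\<^sub>i\<close> (\<open>i :: 'n\<close>) is a finitely supported family of coefficients.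
\<close>
type_synonym ('n, 'k) mpoly = "('n \<Rightarrow>\<^sub>0 nat) \<Rightarrow>\<^sub>0 'k"

definition mpoly_scale :: "'k::field \<Rightarrow> ('n, 'k) mpoly \<Rightarrow> ('n, 'k) mpoly" where
  "mpoly_scale c p = Poly_Mapping.map ((*) c) p"

lemma lookup_mpoly_scale [simp]:
  "Poly_Mapping.lookup (mpoly_scale c p) t = c * Poly_Mapping.lookup p t"
  by (simp add: mpoly_scale_def Poly_Mapping.map.rep_eq when_def)

interpretation mpoly: vector_space mpoly_scale
  by unfold_locales
    (auto intro!: poly_mapping_eqI simp: lookup_add algebra_simps)

definition mpoly_eval :: "('n::finite, 'k::field) mpoly \<Rightarrow> 'k ^ 'n \<Rightarrow> 'k" where
  "mpoly_eval p x =
     (\<Sum>t\<in>Poly_Mapping.keys p.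
        Poly_Mapping.lookup p t * (\<Prod>i\<in>UNIV. (x $ i) ^ Poly_Mapping.lookup t i))"

definition homogeneous_polys :: "nat \<Rightarrow> ('n::finite, 'k::field) mpoly set" where
  "homogeneous_polys m =
     {p. \<forall>t\<in>Poly_Mapping.keys p. (\<Sum>i\<in>UNIV. Poly_Mapping.lookup t i) = m}"

text \<open>
  With \<open>n = CARD('n)\<close>, a point of the projective space \<open>P\<^bsub>n-1\<^esub>(K)\<close> is a one-dimensional
  subspace of \<open>K\<^sup>n\<close>; a representative of the point is a nonzero vector in it.  In
  particular \<open>K\<langle>v\<rangle>\<close> is the point \<open>v\<close> itself.
\<close>
definition projective_space :: "('k::field ^ 'n::finite) set set" where
  "projective_space = {vec.span {x} | x. x \<noteq> 0}"

definition zero_dim_variety :: "('k::field ^ 'n::finite) set set \<Rightarrow> bool" where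
  "zero_dim_variety V \<longleftrightarrow> V \<subseteq> projective_space \<and> finite V \<and> V \<noteq> {}"

definition variety_degree :: "('k::field ^ 'n::finite) set set \<Rightarrow> nat" where
  "variety_degree V = card V"

definition vanishing_polys ::
    "('k::field ^ 'n::finite) set set \<Rightarrow> nat \<Rightarrow> ('n, 'k) mpoly set" where
  "vanishing_polys V m =
     {p \<in> homogeneous_polys m. \<forall>v\<in>V. \<forall>x\<in>v. x \<noteq> 0 \<longrightarrow> mpoly_eval p x = 0}"

definition hilbert_function :: "('k::field ^ 'n::finite) set set \<Rightarrow> nat \<Rightarrow> nat" where
  "hilbert_function V m = dim_quotient mpoly_scale (homogeneous_polys m) (vanishing_polys V m)"

definition hilbert_polynomial :: "('k::field ^ 'n::finite) set set \<Rightarrow> int poly" where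
  "hilbert_polynomial V =
     (THE h. \<exists>R::nat. \<forall>m\<ge>R. int (hilbert_function V m) = poly h (int m))"

definition hilbert_regularity :: "('k::field ^ 'n::finite) set set \<Rightarrow> nat" where
  "hilbert_regularity V =
     (LEAST R. \<forall>m\<ge>R. int (hilbert_function V m) = poly (hilbert_polynomial V) (int m))"

definition affine_line :: "'k::field ^ 'n::finite \<Rightarrow> ('k ^ 'n) set \<Rightarrow> ('k ^ 'n) set" where
  "affine_line x v = {x + y | y. y \<in> v}"

definition kakeya_set ::
    "nat \<Rightarrow> ('k::field ^ 'n::finite) set set \<Rightarrow> ('k ^ 'n) set \<Rightarrow> bool" where
  "kakeya_set q V E \<longleftrightarrow>
     finite E \<and> (\<forall>v\<in>V. \<exists>x\<in>E. q \<le> card (E \<inter> affine_line x v))"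

end

theory Submission
  imports Defs
begin

text \<open>
  Lower bound.  Let \<open>E\<close> be a \<open>q\<close>-Kakeya set and \<open>d \<le> q - 1\<close>.  If \<open>E\<close> had fewer than
  \<open>\<chi>\<^sub>V(d)\<close> points, the vanishing on \<open>E\<close> would impose fewer than \<open>\<chi>\<^sub>V(d)\<close> linear conditions on a
  complement of \<open>I\<^sub>d(V)\<close> in \<open>H\<^sub>d\<close>, so some form \<open>f\<close> of degree \<open>d\<close> outside \<open>I\<^sub>d(V)\<close> would vanish on
  \<open>E\<close>.  Restricted to a line \<open>s \<mapsto> x + s y\<close>, a form of degree \<open>d\<close> becomes a univariate polynomial of
  degree at most \<open>d\<close> whose coefficient at \<open>d\<close> is \<open>f(y)\<close> (\<open>form_on_line\<close>).  The Kakeya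
  property supplies, for each direction in \<open>V\<close>, a line on which this polynomial has \<open>q > d\<close> roots;
  hence \<open>f(y) = 0\<close>, and \<open>f\<close> vanishes on \<open>V\<close> (\<open>form_vanishes_on_directions\<close>), a contradiction.

  Degree.  Finitely many points of projective space are separated by forms of every large degree
  (\<open>separating_form\<close>), namely by products of linear forms.  Therefore \<open>\<chi>\<^sub>V(m) = #V\<close> for large
  \<open>m\<close>, the Hilbert polynomial is the constant \<open>#V\<close>, and \<open>\<chi>\<^sub>V(q - 1) = #V\<close> as soon as \<open>q - 1\<close>
  reaches the regularity.

  Existence.  An algebraically closed field is infinite, so the origin together with \<open>q - 1\<close>
  nonzero points on each line of \<open>V\<close> is a \<open>q\<close>-Kakeya set of the required size.
\<close>

section \<open>Evaluation of polynomials and forms\<close>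

lemma mpoly_eval_superset:
  assumes "finite S" "Poly_Mapping.keys p \<subseteq> S"
  shows "mpoly_eval p x =
    (\<Sum>t\<in>S. Poly_Mapping.lookup p t * (\<Prod>i\<in>UNIV. (x $ i) ^ Poly_Mapping.lookup t i))"
  unfolding mpoly_eval_def
  by (rule sum.mono_neutral_left) (use assms in \<open>auto simp: in_keys_iff\<close>)

lemma mpoly_eval_0 [simp]: "mpoly_eval 0 x = 0"
  by (simp add: mpoly_eval_def)

lemma mpoly_eval_add: "mpoly_eval (p + q) x = mpoly_eval p x + mpoly_eval q x"
proof -
  let ?S = "Poly_Mapping.keys p \<union> Poly_Mapping.keys q"
  have "Poly_Mapping.keys (p + q) \<subseteq> ?S" by (rule Poly_Mapping.keys_add)
  thus ?thesis
    by (subst (1 2 3) mpoly_eval_superset[of ?S])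
       (auto simp: lookup_add sum.distrib algebra_simps)
qed

lemma mpoly_eval_scale: "mpoly_eval (mpoly_scale c p) x = c * mpoly_eval p x"
proof -
  have "Poly_Mapping.keys (mpoly_scale c p) \<subseteq> Poly_Mapping.keys p"
    by (auto simp: in_keys_iff)
  thus ?thesis
    by (subst (1 2) mpoly_eval_superset[of "Poly_Mapping.keys p"])
       (auto simp: sum_distrib_left algebra_simps)
qed

lemma mpoly_eval_minus: "mpoly_eval (p - q) x = mpoly_eval p x - mpoly_eval q x"
proof -
  have "mpoly_eval (p - q + q) x = mpoly_eval (p - q) x + mpoly_eval q x"
    by (rule mpoly_eval_add)
  thus ?thesis by simp
qed

lemma mpoly_eval_sum: "mpoly_eval (\<Sum>a\<in>A. f a) x = (\<Sum>a\<in>A. mpoly_eval (f a) x)"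
  by (induction A rule: infinite_finite_induct) (auto simp: mpoly_eval_add)

lemma mpoly_eval_single:
  "mpoly_eval (Poly_Mapping.single t c) x =
    c * (\<Prod>i\<in>UNIV. (x $ i) ^ Poly_Mapping.lookup t i)"
  by (subst mpoly_eval_superset[of "{t}"]) auto

lemma mpoly_eval_monomial_power:
  "mpoly_eval (Poly_Mapping.single (Poly_Mapping.single i n) c) x = c * (x $ i) ^ n"
proof -
  have "(\<Prod>j\<in>UNIV. (x $ j) ^ Poly_Mapping.lookup (Poly_Mapping.single i n) j) =
      (\<Prod>j\<in>UNIV. if j = i then (x $ i) ^ n else 1)"
    by (intro prod.cong) (auto simp: lookup_single when_def)
  thus ?thesis by (simp add: mpoly_eval_single)
qed

lemma mpoly_eq_sum_singles:
  "p = (\<Sum>t\<in>Poly_Mapping.keys p. Poly_Mapping.single t (Poly_Mapping.lookup p t))"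
proof (rule poly_mapping_eqI)
  fix u
  show "Poly_Mapping.lookup p u = Poly_Mapping.lookup
    (\<Sum>t\<in>Poly_Mapping.keys p. Poly_Mapping.single t (Poly_Mapping.lookup p t)) u"
    by (auto simp: lookup_sum lookup_single when_def in_keys_iff)
qed

lemma mpoly_eval_mult:
  fixes p q :: "('n::finite, 'k::field) mpoly"
  shows "mpoly_eval (p * q) x = mpoly_eval p x * mpoly_eval q x"
proof -
  let ?m = "\<lambda>t. \<Prod>i\<in>UNIV. (x $ i) ^ Poly_Mapping.lookup t i"
  have "p * q = (\<Sum>s\<in>Poly_Mapping.keys p. \<Sum>t\<in>Poly_Mapping.keys q.
      Poly_Mapping.single (s + t) (Poly_Mapping.lookup p s * Poly_Mapping.lookup q t))"
    by (subst mpoly_eq_sum_singles[of p], subst mpoly_eq_sum_singles[of q])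
       (simp add: sum_product mult_single)
  hence "mpoly_eval (p * q) x = (\<Sum>s\<in>Poly_Mapping.keys p. \<Sum>t\<in>Poly_Mapping.keys q.
      (Poly_Mapping.lookup p s * ?m s) * (Poly_Mapping.lookup q t * ?m t))"
    by (simp add: mpoly_eval_sum mpoly_eval_single lookup_add power_add prod.distrib mult_ac)
  also have "\<dots> = mpoly_eval p x * mpoly_eval q x"
    by (simp add: mpoly_eval_def sum_product)
  finally show ?thesis .
qed

lemma homogeneous_polys_single:
  "(\<Sum>i\<in>UNIV. Poly_Mapping.lookup t i) = m \<Longrightarrow> Poly_Mapping.single t c \<in> homogeneous_polys m"
  by (auto simp: homogeneous_polys_def split: if_splits)

lemma homogeneous_polys_monomial_power:
  "Poly_Mapping.single (Poly_Mapping.single i m) c \<in> homogeneous_polys m"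
  by (intro homogeneous_polys_single) (simp add: lookup_single when_def)

lemma subspace_homogeneous_polys: "mpoly.subspace (homogeneous_polys m)"
proof (rule mpoly.subspaceI)
  show "p + q \<in> homogeneous_polys m"
    if "p \<in> homogeneous_polys m" "q \<in> homogeneous_polys m" for p q :: "('n::finite, 'k::field) mpoly"
    using that Poly_Mapping.keys_add[of p q] by (auto simp: homogeneous_polys_def)
qed (auto simp: homogeneous_polys_def in_keys_iff)

lemma homogeneous_polys_mult:
  assumes "p \<in> homogeneous_polys m" "q \<in> homogeneous_polys n"
  shows "p * q \<in> homogeneous_polys (m + n)"
  using assms keys_mult[of p q]
  by (force simp: homogeneous_polys_def lookup_add sum.distrib)

lemma homogeneous_eval_scale:
  assumes "p \<in> homogeneous_polys d"
  shows "mpoly_eval p (c *s x) = c ^ d * mpoly_eval p x"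
proof -
  have "(\<Prod>i\<in>UNIV. (c * x $ i) ^ Poly_Mapping.lookup t i) =
      c ^ d * (\<Prod>i\<in>UNIV. (x $ i) ^ Poly_Mapping.lookup t i)" if "t \<in> Poly_Mapping.keys p" for t
  proof -
    have "(\<Sum>i\<in>UNIV. Poly_Mapping.lookup t i) = d"
      using assms that by (simp add: homogeneous_polys_def)
    thus ?thesis
      by (simp add: power_mult_distrib prod.distrib flip: power_sum)
  qed
  thus ?thesis
    by (simp add: mpoly_eval_def sum_distrib_left mult_ac cong: sum.cong)
qed

section \<open>Forms of degree \<open>m\<close> modulo those vanishing on \<open>V\<close>\<close>

lemma subspace_vanishing_polys: "mpoly.subspace (vanishing_polys V m)"
  using subspace_homogeneous_polys[of m]
  by (auto simp: vanishing_polys_def mpoly.subspace_def mpoly_eval_add mpoly_eval_scale)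

lemma finite_monomials: "finite {t :: 'n::finite \<Rightarrow>\<^sub>0 nat. (\<Sum>i\<in>UNIV. Poly_Mapping.lookup t i) = m}"
    (is "finite ?T")
proof (rule finite_imageD)
  show "inj_on Poly_Mapping.lookup ?T" by (simp add: inj_on_def)
  have "Poly_Mapping.lookup t i \<le> m" if "t \<in> ?T" for t i
    using that member_le_sum[of i UNIV "Poly_Mapping.lookup t"] by auto
  hence "Poly_Mapping.lookup ` ?T \<subseteq> (\<Pi>\<^sub>E i\<in>UNIV. {..m})" by auto
  thus "finite (Poly_Mapping.lookup ` ?T)"
    by (rule finite_subset) (intro finite_PiE, auto)
qed

lemma homogeneous_polys_finite_span:
  "\<exists>S. finite S \<and> (homogeneous_polys m :: ('n::finite, 'k::field) mpoly set) \<subseteq> mpoly.span S"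
proof (intro exI conjI subsetI)
  let ?T = "{t :: 'n \<Rightarrow>\<^sub>0 nat. (\<Sum>i\<in>UNIV. Poly_Mapping.lookup t i) = m}"
  let ?S = "(\<lambda>t. Poly_Mapping.single t (1::'k)) ` ?T"
  show "finite ?S" using finite_monomials by blast
  fix p :: "('n, 'k) mpoly" assume p: "p \<in> homogeneous_polys m"
  have eq: "Poly_Mapping.single t c = mpoly_scale c (Poly_Mapping.single t 1)"
    for t :: "'n \<Rightarrow>\<^sub>0 nat" and c :: 'k
    by (rule poly_mapping_eqI) (simp add: lookup_single when_def)
  have "(\<Sum>t\<in>Poly_Mapping.keys p. Poly_Mapping.single t (Poly_Mapping.lookup p t)) \<in> mpoly.span ?S"
    using p by (subst eq, intro mpoly.span_sum mpoly.span_scale mpoly.span_base)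
      (auto simp: homogeneous_polys_def)
  thus "p \<in> mpoly.span ?S" by (subst mpoly_eq_sum_singles)
qed

lemma vanishing_subset_homogeneous: "vanishing_polys V m \<subseteq> homogeneous_polys m"
  by (auto simp: vanishing_polys_def)

lemma hilbert_function_eq_card:
  fixes V :: "('k::field ^ 'n::finite) set set"
  assumes "quotient_basis mpoly_scale (homogeneous_polys m) (vanishing_polys V m) B"
  shows "hilbert_function V m = card B"
proof -
  obtain S :: "('n, 'k) mpoly set" where S: "finite S" "homogeneous_polys m \<subseteq> mpoly.span S"
    using homogeneous_polys_finite_span by blast
  note * = subspace_vanishing_polys subspace_homogeneous_polys vanishing_subset_homogeneous S
  show ?thesis
    using mpoly.dim_quotient_plus_dim[OF *, of V] mpoly.quotient_basis_card[OF * assms]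
    by (simp add: hilbert_function_def)
qed

lemma hilbert_basis_exists:
  fixes V :: "('k::field ^ 'n::finite) set set"
  shows
  "\<exists>B. quotient_basis mpoly_scale (homogeneous_polys m) (vanishing_polys V m) B"
  using homogeneous_polys_finite_span mpoly.quotient_basis_exists
    subspace_vanishing_polys vanishing_subset_homogeneous by metis

section \<open>Fewer equations than unknowns\<close>

text \<open>Gaussian elimination: each equation is used to eliminate one unknown.\<close>
lemma underdetermined_system:
  fixes M :: "'b \<Rightarrow> 'e \<Rightarrow> 'k::field"
  assumes "finite E" "finite B" "card E < card B"
  shows "\<exists>c. (\<exists>b\<in>B. c b \<noteq> 0) \<and> (\<forall>e\<in>E. (\<Sum>b\<in>B. c b * M b e) = 0)"
  using assms
proof (induction E arbitrary: B M rule: finite_induct)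
  case empty
  hence "B \<noteq> {}" by auto
  thus ?case by (intro exI[of _ "\<lambda>_. 1"]) auto
next
  case (insert e E)
  show ?case
  proof (cases "\<forall>b\<in>B. M b e = 0")
    case True
    from insert have "card E < card B" by simp
    from insert.IH[OF insert.prems(1) this, of M] True show ?thesis by auto
  next
    case False
    then obtain b0 where b0: "b0 \<in> B" "M b0 e \<noteq> 0" by blast
    define M' where "M' b x = M b x - M b e / M b0 e * M b0 x" for b x
    have "card E < card (B - {b0})" using insert b0 by simp
    then obtain c where c: "\<exists>b\<in>B - {b0}. c b \<noteq> 0"
        "\<forall>x\<in>E. (\<Sum>b\<in>B - {b0}. c b * M' b x) = 0"
      using insert.IH[of "B - {b0}" M'] insert.prems by auto
    define c' where "c' = c(b0 := - (\<Sum>b\<in>B - {b0}. c b * M b e) / M b0 e)"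
    have eq: "(\<Sum>b\<in>B. c' b * M b x) = (\<Sum>b\<in>B - {b0}. c b * M' b x)" for x
    proof -
      have "(\<Sum>b\<in>B. c' b * M b x) = c' b0 * M b0 x + (\<Sum>b\<in>B - {b0}. c' b * M b x)"
        by (rule sum.remove) (use insert b0 in auto)
      also have "(\<Sum>b\<in>B - {b0}. c' b * M b x) = (\<Sum>b\<in>B - {b0}. c b * M b x)"
        by (intro sum.cong) (auto simp: c'_def)
      also have "c' b0 * M b0 x = - (\<Sum>b\<in>B - {b0}. c b * (M b e / M b0 e * M b0 x))"
        by (simp add: c'_def sum_divide_distrib sum_distrib_right mult.assoc)
      finally show ?thesis
        by (simp only: M'_def right_diff_distrib sum_subtractf) simp
    qed
    have "M' b e = 0" for b using b0 by (simp add: M'_def)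
    hence "\<forall>x\<in>insert e E. (\<Sum>b\<in>B. c' b * M b x) = 0" using eq c by simp
    moreover have "\<exists>b\<in>B. c' b \<noteq> 0" using c by (auto simp: c'_def)
    ultimately show ?thesis by blast
  qed
qed

section \<open>Forms on lines and the lower bound\<close>

lemma coeff_mult_top:
  fixes p q :: "'a::idom poly"
  assumes "degree p \<le> m" "degree q \<le> n"
  shows "coeff (p * q) (m + n) = coeff p m * coeff q n"
proof (cases "degree p = m \<and> degree q = n")
  case True
  thus ?thesis using coeff_mult_degree_sum by blast
next
  case False
  hence "degree (p * q) < m + n"
    using assms degree_mult_le[of p q] by linarith
  moreover have "coeff p m = 0 \<or> coeff q n = 0"
    using False assms by (metis coeff_eq_0 le_neq_implies_less)
  ultimately show ?thesis by (auto simp: coeff_eq_0)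
qed

lemma linear_power_top:
  fixes a b :: "'a::idom"
  shows "degree ([:a, b:] ^ n) \<le> n \<and> coeff ([:a, b:] ^ n) n = b ^ n"
proof (induction n)
  case (Suc n)
  have "degree [:a, b:] \<le> 1" by simp
  thus ?case
    using Suc coeff_mult_top[of "[:a, b:]" 1 "[:a, b:] ^ n" n]
      degree_mult_le[of "[:a, b:]" "[:a, b:] ^ n"] by (auto split: if_splits)
qed auto

lemma linear_product_top:
  fixes a b :: "'i \<Rightarrow> 'a::idom"
  assumes "finite A"
  shows "degree (\<Prod>i\<in>A. [:a i, b i:] ^ e i) \<le> (\<Sum>i\<in>A. e i) \<and>
    coeff (\<Prod>i\<in>A. [:a i, b i:] ^ e i) (\<Sum>i\<in>A. e i) = (\<Prod>i\<in>A. b i ^ e i)"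
  using assms
proof (induction A rule: finite_induct)
  case (insert x A)
  let ?p = "[:a x, b x:] ^ e x" and ?q = "\<Prod>i\<in>A. [:a i, b i:] ^ e i"
  have "degree (?p * ?q) \<le> e x + (\<Sum>i\<in>A. e i)"
    using degree_mult_le[of ?p ?q] linear_power_top[of "a x" "b x" "e x"] insert.IH by linarith
  moreover have "coeff (?p * ?q) (e x + (\<Sum>i\<in>A. e i)) = b x ^ e x * (\<Prod>i\<in>A. b i ^ e i)"
    using linear_power_top[of "a x" "b x" "e x"] insert.IH by (simp add: coeff_mult_top)
  ultimately show ?case using insert.hyps by simp
qed auto

text \<open>
  Each monomial of degree \<open>d\<close> restricts to a product of \<open>d\<close> linear polynomials
  \<open>x\<^sub>i + y\<^sub>i s\<close>, whose coefficient at \<open>s\<^sup>d\<close> is the monomial evaluated at the direction \<open>y\<close>.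
\<close>
lemma form_on_line:
  fixes p :: "('n::finite, 'k::field) mpoly"
  assumes "p \<in> homogeneous_polys d"
  shows "\<exists>F. degree F \<le> d \<and> coeff F d = mpoly_eval p y \<and>
    (\<forall>s. poly F s = mpoly_eval p (x + s *s y))"
proof -
  define G where "G t = (\<Prod>i\<in>UNIV. [:x $ i, y $ i:] ^ Poly_Mapping.lookup t i)" for t
  define F where "F = (\<Sum>t\<in>Poly_Mapping.keys p. smult (Poly_Mapping.lookup p t) (G t))"
  have G: "degree (G t) \<le> d" "coeff (G t) d = (\<Prod>i\<in>UNIV. (y $ i) ^ Poly_Mapping.lookup t i)"
    if "t \<in> Poly_Mapping.keys p" for t
  proof -
    have "(\<Sum>i\<in>UNIV. Poly_Mapping.lookup t i) = d"
      using assms that by (simp add: homogeneous_polys_def)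
    thus "degree (G t) \<le> d" "coeff (G t) d = (\<Prod>i\<in>UNIV. (y $ i) ^ Poly_Mapping.lookup t i)"
      using linear_product_top[of UNIV "\<lambda>i. x $ i" "\<lambda>i. y $ i" "Poly_Mapping.lookup t"]
      by (simp_all add: G_def)
  qed
  have "degree F \<le> d"
    unfolding F_def by (intro degree_sum_le) (auto intro: order_trans[OF degree_smult_le] G)
  moreover have "coeff F d = mpoly_eval p y"
    by (simp add: F_def coeff_sum G mpoly_eval_def)
  moreover have "poly F s = mpoly_eval p (x + s *s y)" for s
    by (simp add: F_def poly_sum G_def poly_prod poly_power mpoly_eval_def algebra_simps)
  ultimately show ?thesis by blast
qed

lemma projective_point_eq_range:
  assumes "v \<in> projective_space" "x \<in> v" "x \<noteq> 0"
  shows "v = range (\<lambda>s. s *s x)"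
proof -
  obtain y where y: "v = range (\<lambda>s. s *s y)"
    using assms by (auto simp: projective_space_def vec.span_singleton)
  then obtain c where c: "x = c *s y" using assms by auto
  with assms have "c \<noteq> 0" by auto
  hence "s *s y \<in> range (\<lambda>s. s *s x)" for s
    by (intro range_eqI[of _ _ "s / c"]) (simp add: c)
  moreover have "s *s x \<in> range (\<lambda>s. s *s y)" for s
    by (intro range_eqI[of _ _ "s * c"]) (simp add: c)
  ultimately show ?thesis unfolding y by blast
qed

lemma projective_points_disjoint:
  assumes "v \<in> projective_space" "w \<in> projective_space" "x \<in> v" "x \<in> w" "x \<noteq> 0"
  shows "v = w"
proof -
  have "v = range (\<lambda>s. s *s x)" by (rule projective_point_eq_range) fact+
  also have "\<dots> = w" by (rule projective_point_eq_range[symmetric]) fact+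
  finally show ?thesis .
qed

lemma form_vanishes_on_directions:
  fixes V :: "('k::field ^ 'n::finite) set set"
  assumes V: "V \<subseteq> projective_space" and E: "kakeya_set q V E" and d: "d < q"
    and p: "p \<in> homogeneous_polys d" "\<forall>e\<in>E. mpoly_eval p e = 0"
  shows "p \<in> vanishing_polys V d"
  unfolding vanishing_polys_def
proof (intro CollectI conjI ballI impI p(1))
  fix v y assume v: "v \<in> V" "y \<in> v" "y \<noteq> 0"
  obtain x where x: "q \<le> card (E \<inter> affine_line x v)"
    using E v by (auto simp: kakeya_set_def)
  have finE: "finite E" using E by (simp add: kakeya_set_def)
  have v_eq: "v = range (\<lambda>s. s *s y)" using projective_point_eq_range[of v y] V v by auto
  obtain F where F: "degree F \<le> d" "coeff F d = mpoly_eval p y"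
      "\<And>s. poly F s = mpoly_eval p (x + s *s y)"
    using form_on_line[OF p(1)] by metis
  have "F = 0"
  proof (rule ccontr)
    assume "F \<noteq> 0"
    have "E \<inter> affine_line x v \<subseteq> (\<lambda>s. x + s *s y) ` {s. poly F s = 0}"
      using p(2) by (auto simp: affine_line_def v_eq F(3))
    hence "card (E \<inter> affine_line x v) \<le> card {s. poly F s = 0}"
      using poly_roots_finite[OF \<open>F \<noteq> 0\<close>] by (rule surj_card_le[rotated])
    also have "\<dots> \<le> degree F" by (rule card_poly_roots_bound[OF \<open>F \<noteq> 0\<close>])
    finally show False using F(1) d x by linarith
  qed
  thus "mpoly_eval p y = 0" using F(2) by simp
qed

lemma hilbert_function_le_card_kakeya:
  fixes V :: "('k::field ^ 'n::finite) set set"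
  assumes V: "V \<subseteq> projective_space" and E: "kakeya_set q V E" and d: "d < q"
  shows "hilbert_function V d \<le> card E"
proof (rule ccontr)
  assume less: "\<not> ?thesis"
  obtain B where B: "quotient_basis mpoly_scale (homogeneous_polys d) (vanishing_polys V d) B"
    using hilbert_basis_exists by blast
  have "finite E" "finite B" "card E < card B"
    using E B less by (auto simp: kakeya_set_def quotient_basis_def hilbert_function_eq_card[OF B])
  then obtain c where c: "\<exists>b\<in>B. c b \<noteq> 0" "\<forall>e\<in>E. (\<Sum>b\<in>B. c b * mpoly_eval b e) = 0"
    using underdetermined_system[of E B mpoly_eval] by blast
  define f where "f = (\<Sum>b\<in>B. mpoly_scale (c b) b)"
  have "f \<in> homogeneous_polys d"
    using B unfolding f_def quotient_basis_def
    by (intro mpoly.subspace_sum mpoly.subspace_scale subspace_homogeneous_polys) auto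
  moreover have "\<forall>e\<in>E. mpoly_eval f e = 0"
    using c(2) by (simp add: f_def mpoly_eval_sum mpoly_eval_scale)
  ultimately have "f \<in> vanishing_polys V d"
    using form_vanishes_on_directions[OF V E d] by blast
  thus False using B c(1) unfolding quotient_basis_def f_def by blast
qed

section \<open>The Hilbert function in large degree\<close>

text \<open>
  If \<open>x\<close> is not proportional to \<open>y\<close>, some \<open>2 \<times> 2\<close> minor \<open>y\<^sub>j X\<^sub>i - y\<^sub>i X\<^sub>j\<close> is a linear
  form that vanishes at \<open>y\<close> but not at \<open>x\<close>.  Multiplying such forms, one for each \<open>y\<close>, with a power
  of a coordinate that is nonzero at \<open>x\<close> gives all degrees from \<open>card W\<close> on.
\<close>
lemma separating_form:
  fixes x :: "'k::field ^ 'n::finite"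
  assumes "finite W" "x \<noteq> 0" "\<And>y. y \<in> W \<Longrightarrow> y \<noteq> 0 \<and> x \<notin> range (\<lambda>s. s *s y)" "card W \<le> m"
  shows "\<exists>p\<in>homogeneous_polys m. mpoly_eval p x \<noteq> 0 \<and> (\<forall>y\<in>W. mpoly_eval p y = 0)"
  using assms
proof (induction W arbitrary: m rule: finite_induct)
  case empty
  then obtain i where "x $ i \<noteq> 0" by (auto simp: vec_eq_iff)
  thus ?case
    by (intro bexI[of _ "Poly_Mapping.single (Poly_Mapping.single i m) 1"])
       (auto simp: mpoly_eval_monomial_power homogeneous_polys_monomial_power)
next
  case (insert y W)
  from insert.prems insert.hyps obtain m' where m': "m = m' + 1" "card W \<le> m'"
    by (cases m) auto
  obtain p where p: "p \<in> homogeneous_polys m'" "mpoly_eval p x \<noteq> 0" "\<forall>y\<in>W. mpoly_eval p y = 0"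
    using insert.IH[of m'] insert.prems m' by auto
  have y: "y \<noteq> 0" "x \<notin> range (\<lambda>s. s *s y)" using insert.prems by auto
  obtain j where j: "y $ j \<noteq> 0" using y by (auto simp: vec_eq_iff)
  have "x \<noteq> (x $ j / y $ j) *s y" using y by blast
  then obtain i where "x $ i \<noteq> x $ j / y $ j * y $ i" by (auto simp: vec_eq_iff)
  hence ij: "y $ j * x $ i - y $ i * x $ j \<noteq> 0" using j by (auto simp: field_simps)
  define l where "l = Poly_Mapping.single (Poly_Mapping.single i (1::nat)) (y $ j)
    - Poly_Mapping.single (Poly_Mapping.single j 1) (y $ i)"
  have l: "l \<in> homogeneous_polys 1"
    unfolding l_def
    by (intro mpoly.subspace_diff subspace_homogeneous_polys homogeneous_polys_monomial_power)
  have ev: "mpoly_eval l z = y $ j * z $ i - y $ i * z $ j" for z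
    by (simp only: l_def mpoly_eval_minus mpoly_eval_monomial_power power_one_right)
  have "p * l \<in> homogeneous_polys m"
    using homogeneous_polys_mult[OF p(1) l] m' by simp
  moreover have "mpoly_eval (p * l) x \<noteq> 0" "\<forall>z\<in>insert y W. mpoly_eval (p * l) z = 0"
    using p ij by (auto simp: mpoly_eval_mult ev)
  ultimately show ?case by blast
qed

text \<open>By homogeneity, the vanishing at a projective point is decided by any one representative.\<close>
lemma vanishing_polys_iff_representatives:
  assumes "V \<subseteq> projective_space" "\<And>v. v \<in> V \<Longrightarrow> r v \<in> v \<and> r v \<noteq> 0"
  shows "p \<in> vanishing_polys V m \<longleftrightarrow> p \<in> homogeneous_polys m \<and> (\<forall>v\<in>V. mpoly_eval p (r v) = 0)"
proof -
  have "mpoly_eval p x = 0"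
    if p: "p \<in> homogeneous_polys m" "v \<in> V" "mpoly_eval p (r v) = 0" "x \<in> v" for v x
  proof -
    have "v = range (\<lambda>s. s *s r v)" using projective_point_eq_range[of v "r v"] assms p by auto
    then obtain c where "x = c *s r v" using p(4) by blast
    thus ?thesis using p(3) homogeneous_eval_scale[OF p(1)] by simp
  qed
  thus ?thesis using assms(2) by (auto simp: vanishing_polys_def)
qed

lemma projective_representatives:
  assumes "V \<subseteq> projective_space"
  obtains r where "\<And>v. v \<in> V \<Longrightarrow> r v \<in> v \<and> r v \<noteq> 0"
proof -
  have "\<exists>x. x \<in> v \<and> x \<noteq> 0" if "v \<in> V" for v
    using assms that by (auto simp: projective_space_def intro: vec.span_base)
  with that show thesis by metis
qed

text \<open>The separating forms of the points of \<open>V\<close> represent a basis of \<open>H\<^sub>m / I\<^sub>m(V)\<close>.\<close>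
lemma hilbert_function_eq_card_points:
  fixes V :: "('k::field ^ 'n::finite) set set"
  assumes V: "V \<subseteq> projective_space" "finite V" and m: "card V \<le> m"
  shows "hilbert_function V m = card V"
proof -
  obtain r where r: "\<And>v. v \<in> V \<Longrightarrow> r v \<in> v \<and> r v \<noteq> 0"
    using projective_representatives[OF V(1)] by blast
  have van: "p \<in> vanishing_polys V m \<longleftrightarrow>
      p \<in> homogeneous_polys m \<and> (\<forall>v\<in>V. mpoly_eval p (r v) = 0)" for p
    by (rule vanishing_polys_iff_representatives) (use V r in auto)
  have sep: "\<exists>p\<in>homogeneous_polys m. mpoly_eval p (r v) \<noteq> 0 \<and> (\<forall>y\<in>r ` (V - {v}). mpoly_eval p y = 0)"
    if v: "v \<in> V" for v
  proof (rule separating_form)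
    show "card (r ` (V - {v})) \<le> m"
      using V m card_image_le[of "V - {v}" r] card_Diff1_le[of V v] by simp
    fix y assume "y \<in> r ` (V - {v})"
    then obtain w where w: "w \<in> V" "w \<noteq> v" "y = r w" by auto
    have "r v \<notin> w"
      using projective_points_disjoint[of v w "r v"] r v w V by auto
    moreover have "w = range (\<lambda>s. s *s y)"
      by (rule projective_point_eq_range) (use r w V in auto)
    moreover have "y \<noteq> 0" using r w by auto
    ultimately show "y \<noteq> 0 \<and> r v \<notin> range (\<lambda>s. s *s y)" by blast
  qed (use V v r in auto)
  have "\<forall>v\<in>V. \<exists>p. p \<in> homogeneous_polys m \<and> mpoly_eval p (r v) \<noteq> 0 \<and>
      (\<forall>w\<in>V. w \<noteq> v \<longrightarrow> mpoly_eval p (r w) = 0)"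
  proof
    fix v assume "v \<in> V"
    from sep[OF this] obtain p where p: "p \<in> homogeneous_polys m" "mpoly_eval p (r v) \<noteq> 0"
        "\<forall>y\<in>r ` (V - {v}). mpoly_eval p y = 0" by blast
    from p(3) have "\<forall>w\<in>V. w \<noteq> v \<longrightarrow> mpoly_eval p (r w) = 0" by simp
    with p show "\<exists>p. p \<in> homogeneous_polys m \<and> mpoly_eval p (r v) \<noteq> 0 \<and>
      (\<forall>w\<in>V. w \<noteq> v \<longrightarrow> mpoly_eval p (r w) = 0)" by blast
  qed
  from bchoice[OF this] obtain f where choice: "\<forall>v\<in>V. f v \<in> homogeneous_polys m \<and>
      mpoly_eval (f v) (r v) \<noteq> 0 \<and> (\<forall>w\<in>V. w \<noteq> v \<longrightarrow> mpoly_eval (f v) (r w) = 0)"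
    by blast
  have f: "\<And>v. v \<in> V \<Longrightarrow> f v \<in> homogeneous_polys m"
      "\<And>v. v \<in> V \<Longrightarrow> mpoly_eval (f v) (r v) \<noteq> 0"
      "\<And>v w. v \<in> V \<Longrightarrow> w \<in> V \<Longrightarrow> w \<noteq> v \<Longrightarrow> mpoly_eval (f v) (r w) = 0"
    using choice by blast+
  have inj: "inj_on f V"
    by (rule inj_onI) (metis f(2,3))
  have ev: "mpoly_eval (\<Sum>b\<in>f ` V. mpoly_scale (c b) b) (r w) = c (f w) * mpoly_eval (f w) (r w)"
    if w: "w \<in> V" for c w
  proof -
    have "mpoly_eval (\<Sum>b\<in>f ` V. mpoly_scale (c b) b) (r w) =
        (\<Sum>v\<in>V. c (f v) * mpoly_eval (f v) (r w))"
      by (simp add: sum.reindex[OF inj] mpoly_eval_sum mpoly_eval_scale)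
    also have "\<dots> = (\<Sum>v\<in>V. if v = w then c (f w) * mpoly_eval (f w) (r w) else 0)"
      by (intro sum.cong) (use w f(3) in auto)
    finally show ?thesis using V(2) w by simp
  qed
  have "quotient_basis mpoly_scale (homogeneous_polys m) (vanishing_polys V m) (f ` V)"
    unfolding quotient_basis_def
  proof (intro conjI allI impI ballI)
    show "finite (f ` V)" "f ` V \<subseteq> homogeneous_polys m" using V f by auto
  next
    fix c b assume "(\<Sum>b\<in>f ` V. mpoly_scale (c b) b) \<in> vanishing_polys V m" "b \<in> f ` V"
    thus "c b = 0" using ev f(2) by (auto simp: van)
  next
    fix p :: "('n, 'k) mpoly" assume p: "p \<in> homogeneous_polys m"
    define c where "c b = mpoly_eval p (r (inv_into V f b)) / mpoly_eval b (r (inv_into V f b))" for b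
    have "p - (\<Sum>b\<in>f ` V. mpoly_scale (c b) b) \<in> homogeneous_polys m"
      by (intro mpoly.subspace_diff mpoly.subspace_sum mpoly.subspace_scale
            subspace_homogeneous_polys p) (use f in auto)
    moreover have "mpoly_eval (p - (\<Sum>b\<in>f ` V. mpoly_scale (c b) b)) (r w) = 0" if "w \<in> V" for w
      using that f(2) by (simp add: mpoly_eval_minus ev c_def inv_into_f_f[OF inj])
    ultimately show "\<exists>c. p - (\<Sum>b\<in>f ` V. mpoly_scale (c b) b) \<in> vanishing_polys V m"
      by (auto simp: van)
  qed
  thus ?thesis using hilbert_function_eq_card card_image[OF inj] by metis
qed

lemma hilbert_polynomial_eq_card:
  fixes V :: "('k::field ^ 'n::finite) set set"
  assumes V: "V \<subseteq> projective_space" "finite V"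
  shows "hilbert_polynomial V = [:int (card V):]"
  unfolding hilbert_polynomial_def
proof (rule the_equality)
  show "\<exists>R. \<forall>m\<ge>R. int (hilbert_function V m) = poly [:int (card V):] (int m)"
    using hilbert_function_eq_card_points[OF V] by auto
next
  fix h :: "int poly" assume "\<exists>R. \<forall>m\<ge>R. int (hilbert_function V m) = poly h (int m)"
  then obtain R where R: "\<And>m. m \<ge> R \<Longrightarrow> int (hilbert_function V m) = poly h (int m)" by blast
  have "int ` {max R (card V)..} \<subseteq> {z. poly (h - [:int (card V):]) z = 0}"
    using R hilbert_function_eq_card_points[OF V] by fastforce
  moreover have "infinite (int ` {max R (card V)..})"
    by (simp add: finite_image_iff infinite_Ici)
  ultimately have "h - [:int (card V):] = 0"
    using poly_roots_finite finite_subset by blast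
  thus "h = [:int (card V):]" by simp
qed

lemma hilbert_function_from_regularity:
  fixes V :: "('k::field ^ 'n::finite) set set"
  assumes V: "V \<subseteq> projective_space" "finite V" and m: "hilbert_regularity V \<le> m"
  shows "hilbert_function V m = card V"
proof -
  have "\<forall>m\<ge>hilbert_regularity V. int (hilbert_function V m) = poly (hilbert_polynomial V) (int m)"
    unfolding hilbert_regularity_def
    by (rule LeastI[of _ "card V"])
       (use hilbert_function_eq_card_points[OF V] hilbert_polynomial_eq_card[OF V] in auto)
  thus ?thesis using m by (simp add: hilbert_polynomial_eq_card[OF V])
qed

section \<open>A small Kakeya set\<close>

text \<open>If the field were finite, \<open>1 + (\<Prod>a. X - a)\<close> would have no root.\<close>
lemma infinite_alg_closed_field: "infinite (UNIV :: 'k::alg_closed_field set)"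
proof
  assume fin: "finite (UNIV :: 'k set)"
  define P :: "'k poly" where "P = (\<Prod>a\<in>UNIV. [:- a, 1:])"
  have "degree P = (\<Sum>a\<in>(UNIV :: 'k set). degree [:- a, 1:])"
    unfolding P_def by (rule degree_prod_sum_eq) auto
  hence "degree P = card (UNIV :: 'k set)" by simp
  moreover have "card (UNIV :: 'k set) > 0" using fin by (simp add: card_gt_0_iff)
  ultimately have "degree (P + 1) > 0" by (simp add: degree_add_eq_left)
  then obtain x where "poly (P + 1) x = 0" using alg_closed_imp_poly_has_root by blast
  moreover have "poly P x = 0" using fin by (auto simp: P_def poly_prod)
  ultimately show False by simp
qed

lemma small_kakeya_set_exists:
  fixes V :: "('k::field ^ 'n::finite) set set"
  assumes inf: "infinite (UNIV :: 'k set)" and V: "V \<subseteq> projective_space" "finite V" and q: "q > 0"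
  shows "\<exists>E. kakeya_set q V E \<and> card E = (q - 1) * card V + 1"
proof -
  have "infinite (UNIV - {0 :: 'k})" using inf by simp
  then obtain C where C: "C \<subseteq> UNIV - {0 :: 'k}" "finite C" "card C = q - 1"
    using infinite_arbitrarily_large by blast
  obtain r where r: "\<And>v. v \<in> V \<Longrightarrow> r v \<in> v \<and> r v \<noteq> 0"
    using projective_representatives[OF V(1)] by blast
  have scale_mem: "c *s r v \<in> v" if "v \<in> V" for c v
    using projective_point_eq_range[of v "r v"] V(1) r that by blast
  let ?g = "\<lambda>(v, c). c *s r v"
  let ?E = "insert 0 (?g ` (V \<times> C))"
  have inj: "inj_on ?g (V \<times> C)"
  proof (clarsimp simp: inj_on_def)
    fix v c w d assume *: "v \<in> V" "c \<in> C" "w \<in> V" "d \<in> C" "c *s r v = d *s r w"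
    have "c *s r v \<noteq> 0" using C r * by auto
    moreover have "c *s r v \<in> v" using scale_mem * by blast
    moreover have "c *s r v \<in> w" unfolding *(5) using scale_mem * by blast
    ultimately have "v = w" using projective_points_disjoint[of v w "c *s r v"] V(1) * by blast
    thus "v = w \<and> c = d" using * r by auto
  qed
  have "0 \<notin> ?g ` (V \<times> C)" using C r by force
  hence card: "card ?E = (q - 1) * card V + 1"
    using V C by (simp add: card_image[OF inj] card_cartesian_product mult.commute)
  have "q \<le> card (?E \<inter> affine_line 0 v)" if v: "v \<in> V" for v
  proof -
    have inj0: "inj (\<lambda>c. c *s r v)" using r v by (auto simp: inj_def)
    have "0 \<notin> C" using C by auto
    hence "q = card ((\<lambda>c. c *s r v) ` insert 0 C)"
      using C q by (simp add: card_image[OF inj_on_subset[OF inj0 subset_UNIV]] del: image_insert)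
    also have "\<dots> \<le> card (?E \<inter> affine_line 0 v)"
    proof (rule card_mono)
      have "(\<lambda>c. c *s r v) ` insert 0 C \<subseteq> v" using scale_mem v by blast
      moreover have "affine_line 0 v = v" by (auto simp: affine_line_def)
      moreover have "(\<lambda>c. c *s r v) ` insert 0 C \<subseteq> ?E" using v by auto
      ultimately show "(\<lambda>c. c *s r v) ` insert 0 C \<subseteq> ?E \<inter> affine_line 0 v" by blast
    qed (use V C in auto)
    finally show ?thesis .
  qed
  hence "kakeya_set q V ?E" using V C unfolding kakeya_set_def by blast
  with card show ?thesis by blast
qed

theorem propositionB1:
  fixes q :: nat and V :: "('k::alg_closed_field ^ 'n::finite) set set"
  assumes "q > 0" and "zero_dim_variety V"
  shows "(\<forall>E. kakeya_set q V E \<longrightarrow> (\<forall>d\<le>q - 1. card E \<ge> hilbert_function V d)) \<and>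
         (\<forall>E. kakeya_set q V E \<longrightarrow> q - 1 \<ge> hilbert_regularity V \<longrightarrow>
              card E \<ge> card V \<and> card V = variety_degree V) \<and>
         (\<exists>E. kakeya_set q V E \<and> card E = (q - 1) * variety_degree V + 1)"
proof -
  have V: "V \<subseteq> projective_space" "finite V" using assms by (auto simp: zero_dim_variety_def)
  have bound: "hilbert_function V d \<le> card E" if "kakeya_set q V E" "d \<le> q - 1" for E d
    using hilbert_function_le_card_kakeya[OF V(1) that(1)] that(2) assms(1) by simp
  moreover have "card V \<le> card E" if "kakeya_set q V E" "hilbert_regularity V \<le> q - 1" for E
    using bound[OF that(1), of "q - 1"] hilbert_function_from_regularity[OF V that(2)] by simp
  moreover have "\<exists>E. kakeya_set q V E \<and> card E = (q - 1) * card V + 1"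
    using small_kakeya_set_exists[OF infinite_alg_closed_field V assms(1)] .
  ultimately show ?thesis by (simp add: variety_degree_def)
qed

end
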